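(* Let $S$ be a numerical semigroup with multiplicity $m$ and embedding dimension $\nu$. If $m-\nu=5$, then $S$ satisfies Wilf's Conjecture, i.e. $f+1\le \nu n$.
   Context: A numerical semigroup is a submonoid of $(\mathbb N,+)$ with finite complement. $f$ is its Frobenius number (largest integer not in $S$), $m$ its smallest nonzero element, $\nu$ its minimal number of generators, and $n=|\{s\in S: s<f\}|$. *)

theory Defs
  imports Main "HOL.Hull"
begin

definition add_submonoid :: "nat set \<Rightarrow> bool" where
  "add_submonoid S \<longleftrightarrow> 0 \<in> S \<and> (\<forall>x\<in>S. \<forall>y\<in>S. x + y \<in> S)"

definition numerical_semigroup :: "nat set \<Rightarrow> bool" where
  "numerical_semigroup S \<longleftrightarrow> add_submonoid S \<and> finite (- S)"

text \<open>The Frobenius number is taken in the integers, so that it equals \<open>-1\<close> when \<open>S\<close> is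
  all of the natural numbers.\<close>

definition frobenius_number :: "nat set \<Rightarrow> int" where
  "frobenius_number S = (GREATEST z. z \<notin> int ` S)"

definition semigroup_multiplicity :: "nat set \<Rightarrow> nat" where
  "semigroup_multiplicity S = (LEAST s. s \<in> S \<and> s \<noteq> 0)"

text \<open>The term \<open>add_submonoid hull A\<close> is the intersection of all submonoids containing \<open>A\<close>, i.e. the
  submonoid generated by \<open>A\<close>. The minimum exists because numerical semigroups are finitely
  generated; the condition \<open>finite A\<close> excludes infinite generating sets, for which \<open>card\<close> is
  \<open>0\<close>.\<close>

definition embedding_dimension :: "nat set \<Rightarrow> nat" where
  "embedding_dimension S = (LEAST k. \<exists>A. finite A \<and> card A = k \<and> add_submonoid hull A = S)"

definition num_below_frobenius :: "nat set \<Rightarrow> nat" where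
  "num_below_frobenius S = card {s \<in> S. int s < frobenius_number S}"

end

theory Submission
  imports Defs
begin

text \<open>
  Let \<open>Ap\<close> be the Apery set of \<open>S\<close> with respect to \<open>m\<close>, whose maximum is \<open>W = F + m\<close>. Exactly
  \<open>m - \<nu> = 5\<close> nonzero elements of \<open>Ap\<close> are sums of two nonzero elements of \<open>Ap\<close>. Order \<open>Ap\<close> by
  \<open>u \<le> v \<longleftrightarrow> v - u \<in> S\<close> and let \<open>t\<close> be the number of maximal elements.

  On the one hand, each gap \<open>g\<close> satisfies \<open>g + s + m = w\<close> for some maximal \<open>w\<close> and some \<open>s \<in> S\<close> with
  \<open>s < F\<close>, so that \<open>F + 1 \<le> (t + 1) n\<close>; this settles the case \<open>t < \<nu>\<close>, which includes \<open>\<nu> \<le> 3\<close>.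

  On the other hand, \<open>n\<close> is the sum over \<open>w \<in> Ap\<close> of the depths \<open>(W - w) div m\<close>. With \<open>q = W div m\<close>,
  the depths of \<open>u\<close> and \<open>v\<close> add up to at least \<open>q - 1\<close> whenever \<open>u + v \<in> Ap\<close>, and nonmaximal elements
  have positive depth. Regarding the five decomposable elements as edges of a graph (with loops) on
  the nonmaximal elements, fractional matchings of this graph bound the total depth from below.
  For \<open>\<nu> \<ge> 5\<close> the resulting bound is always sufficient. For \<open>\<nu> = 4\<close> and \<open>t \<ge> 4\<close> there are only three or
  four nonmaximal elements, so the five edges cannot form a star, which gives a stronger bound.
\<close>

section \<open>Edge inequalities for weighted graphs with loops on three and four vertices\<close>

text \<open>At most one of the six edges fails, so all three loops or all three sides of the
  triangle satisfy the inequality; adding those three gives the bound.\<close>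

lemma three_weights:
  fixes a b c q :: nat
  assumes "5 \<le> length (filter (\<lambda>(u, v). q \<le> u + v + k) [(a, a), (a, b), (a, c), (b, b), (b, c), (c, c)])"
  shows "3 * q \<le> 2 * (a + b + c) + 3 * k"
  using assms by (simp split: if_splits)

text \<open>Five edges on four vertices include two disjoint non-loops, a triangle, or a non-loop
  disjoint from a loop. With \<open>D = a + b + c + d\<close>, the first gives
  \<open>D \<ge> 2 * (q - 1)\<close>; the other two leave one vertex of weight at least 1, so
  \<open>2 * D \<ge> 3 * (q - 1) + 2\<close>. Small \<open>q\<close> is covered by
  \<open>D \<ge> 4\<close>.\<close>

lemma four_weights:
  fixes a b c d q :: nat
  assumes "5 \<le> length (filter (\<lambda>(u, v). q \<le> u + v + 1)
      [(a, a), (a, b), (a, c), (a, d), (b, b), (b, c), (b, d), (c, c), (c, d), (d, d)])"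
    and "1 \<le> a" "1 \<le> b" "1 \<le> c" "1 \<le> d"
  shows "5 * q \<le> 4 * (a + b + c + d)"
  using assms by (simp split: if_splits)

lemma combination_split:
  fixes a b :: nat
  assumes "k \<le> k'" "l \<le> l'"
  shows "k' * a + l' * b = (k * a + l * b) + ((k' - k) * a + (l' - l) * b)"
proof -
  obtain x y where "k' = k + x" "l' = l + y" using assms le_Suc_ex by metis
  then show ?thesis by (simp add: add_mult_distrib)
qed

section \<open>The Apery set\<close>

locale numsgp =
  fixes S :: "nat set" and m F :: nat
  assumes zero: "0 \<in> S"
    and add: "x \<in> S \<Longrightarrow> y \<in> S \<Longrightarrow> x + y \<in> S"
    and m_in: "m \<in> S" and m_pos: "0 < m"
    and m_le: "s \<in> S \<Longrightarrow> s \<noteq> 0 \<Longrightarrow> m \<le> s"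
    and F_notin: "F \<notin> S"
    and F_less: "F < s \<Longrightarrow> s \<in> S"
begin

text \<open>Subtraction is avoided: with truncation \<open>0 - m\<close> would be \<open>0\<close>,
  an element of \<open>S\<close>, and \<open>0\<close> would be lost.\<close>

definition Ap :: "nat set" where
  "Ap = {s \<in> S. \<forall>t\<in>S. s \<noteq> t + m}"

definition Irr :: "nat set" where
  "Irr = {s \<in> S. s \<noteq> 0 \<and> (\<forall>u\<in>S. \<forall>v\<in>S. s = u + v \<longrightarrow> u = 0 \<or> v = 0)}"

definition NonMax :: "nat set" where
  "NonMax = {w \<in> Ap - {0}. \<exists>v\<in>Ap - {0}. w + v \<in> Ap}"

definition Maxl :: "nat set" where
  "Maxl = Ap - {0} - NonMax"

text \<open>For \<open>w \<in> Ap\<close> this is the number of elements of \<open>S\<close> below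
  \<open>F\<close> that are congruent to \<open>w\<close> modulo \<open>m\<close>.\<close>

definition depth :: "nat \<Rightarrow> nat" where
  "depth w = (F + m - w) div m"

lemma mult_m_in: "k * m \<in> S"
  by (induction k) (auto intro: zero add m_in)

lemma Ap_in: "w \<in> Ap \<Longrightarrow> w \<in> S"
  by (simp add: Ap_def)

lemma zero_Ap: "0 \<in> Ap"
  using zero m_pos by (auto simp: Ap_def)

lemma Ap_left:
  assumes "u \<in> S" "v \<in> S" "u + v \<in> Ap"
  shows "u \<in> Ap"
proof -
  { fix t assume "t \<in> S" "u = t + m"
    then have "u + v = (t + v) + m" "t + v \<in> S" using add assms by auto
    then have False using assms(3) unfolding Ap_def by blast }
  then show ?thesis using assms by (auto simp: Ap_def)
qed

lemma Ap_right: "u \<in> S \<Longrightarrow> v \<in> S \<Longrightarrow> u + v \<in> Ap \<Longrightarrow> v \<in> Ap"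
  using Ap_left[of v u] by (simp add: add.commute)

lemma Ap_le: assumes "w \<in> Ap" shows "w \<le> F + m"
proof (rule ccontr)
  assume "\<not> w \<le> F + m"
  then have "w - m \<in> S" "w = (w - m) + m" using F_less by auto
  then show False using assms unfolding Ap_def by blast
qed

lemma finite_Ap: "finite Ap"
  using Ap_le by (meson finite_nat_set_iff_bounded_le)

lemma finite_NonMax: "finite NonMax"
  using finite_Ap by (simp add: NonMax_def)

lemma finite_Maxl: "finite Maxl"
  using finite_Ap by (simp add: Maxl_def)

lemma Ap_gt_m: assumes "w \<in> Ap" "w \<noteq> 0" shows "m < w"
proof -
  have "m \<le> w" using assms Ap_in m_le by auto
  moreover have "w \<noteq> m" using assms zero unfolding Ap_def by force
  ultimately show ?thesis by simp
qed

lemma Ap_add_mult_notin: assumes "s \<in> S" "0 < k" shows "s + k * m \<notin> Ap"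
proof -
  obtain l where "k = Suc l" using assms by (cases k) auto
  then have "s + k * m = (s + l * m) + m" "s + l * m \<in> S"
    using assms add mult_m_in by auto
  then show ?thesis unfolding Ap_def by blast
qed

lemma in_S_decompose:
  "s \<in> S \<Longrightarrow> \<exists>w\<in>Ap. \<exists>k. s = w + k * m"
proof (induction s rule: less_induct)
  case (less s)
  show ?case
  proof (cases "s \<in> Ap")
    case True then show ?thesis by (intro bexI[of _ s] exI[of _ 0]) auto
  next
    case False
    then obtain t where t: "t \<in> S" "s = t + m" using less.prems unfolding Ap_def by blast
    then obtain w k where "w \<in> Ap" "t = w + k * m" using less.IH[of t] m_pos by auto
    then show ?thesis using t by (intro bexI[of _ w] exI[of _ "Suc k"]) auto
  qed
qed

lemma Ap_mult_unique:
  assumes "w \<in> Ap" "w' \<in> Ap" "w + k * m = w' + k' * m"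
  shows "w = w' \<and> k = k'"
proof -
  have aux: "k' \<le> k" if "w \<in> Ap" "w' \<in> Ap" "w + k * m = w' + k' * m" for w w' k k'
  proof (rule ccontr)
    assume "\<not> k' \<le> k"
    then have k: "k' = k + (k' - k)" "0 < k' - k" by auto
    have "w + k * m = w' + (k' - k) * m + k * m"
      using that(3) k(1) by (metis add.assoc add.commute add_mult_distrib)
    then have "w = w' + (k' - k) * m" by simp
    then show False using Ap_add_mult_notin[OF Ap_in[OF that(2)] k(2)] that(1) by simp
  qed
  have "k = k'" using aux[OF assms] aux[OF assms(2,1) assms(3)[symmetric]] by simp
  then show ?thesis using assms(3) by simp
qed

lemma Ap_mod_inj:
  assumes "w \<in> Ap" "w' \<in> Ap" "w mod m = w' mod m"
  shows "w = w'"
proof -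
  have "w + (w' div m) * m = w' + (w div m) * m"
    using assms(3) by (metis add.commute add.left_commute div_mult_mod_eq)
  then show ?thesis using Ap_mult_unique assms by blast
qed

lemma card_Ap: "card Ap = m"
proof -
  have "bij_betw (\<lambda>w. w mod m) Ap {..<m}"
    unfolding bij_betw_def
  proof
    show "inj_on (\<lambda>w. w mod m) Ap" using Ap_mod_inj by (auto intro: inj_onI)
    show "(\<lambda>w. w mod m) ` Ap = {..<m}"
    proof
      show "(\<lambda>w. w mod m) ` Ap \<subseteq> {..<m}" using m_pos by auto
      show "{..<m} \<subseteq> (\<lambda>w. w mod m) ` Ap"
      proof
        fix r assume r: "r \<in> {..<m}"
        have "Suc F \<le> Suc F * m" using m_pos by (metis Suc_leI One_nat_def mult_le_mono2 nat_mult_1_right)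
        then have "r + Suc F * m \<in> S" using F_less by auto
        then obtain w k where w: "w \<in> Ap" "r + Suc F * m = w + k * m"
          using in_S_decompose by blast
        have "w mod m = (r + Suc F * m) mod m" by (simp only: w(2) mod_mult_self1)
        also have "\<dots> = r" using r by (simp only: mod_mult_self1) simp
        finally show "r \<in> (\<lambda>w. w mod m) ` Ap" using w(1) by force
      qed
    qed
  qed
  then show ?thesis using bij_betw_same_card by fastforce
qed

section \<open>Atoms and decomposable Apery elements\<close>

lemma Irr_subset: "Irr \<subseteq> insert m (Ap - {0})"
proof
  fix s assume s: "s \<in> Irr"
  then have "s \<in> S" "s \<noteq> 0" by (auto simp: Irr_def)
  moreover have "s \<in> Ap" if "s \<noteq> m"
  proof (rule ccontr)
    assume "s \<notin> Ap"
    then obtain t where "t \<in> S" "s = t + m" using \<open>s \<in> S\<close> unfolding Ap_def by blast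
    then show False using s that m_in m_pos unfolding Irr_def by fastforce
  qed
  ultimately show "s \<in> insert m (Ap - {0})" by blast
qed

lemma m_in_Irr: "m \<in> Irr"
proof -
  { fix u v assume "u \<in> S" "v \<in> S" "m = u + v" "u \<noteq> 0" "v \<noteq> 0"
    then have False using m_le[of u] m_le[of v] m_pos by auto }
  then show ?thesis using m_in m_pos by (auto simp: Irr_def)
qed

lemma finite_Irr: "finite Irr"
  using Irr_subset finite_Ap by (meson finite_Diff finite_insert finite_subset)

lemma m_notin_Ap: "m \<notin> Ap"
  using zero unfolding Ap_def by force

text \<open>Every atom except \<open>m\<close> is one of the \<open>m - 1\<close> nonzero Apery
  elements, so \<open>m - card Irr\<close> of these are decomposable.\<close>

lemma card_decomposable: "card (Ap - {0} - Irr) + card Irr = m"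
proof -
  have "Ap - {0} = (Ap - {0} - Irr) \<union> (Irr - {m})"
    using Irr_subset m_notin_Ap by blast
  then have "card (Ap - {0}) = card (Ap - {0} - Irr) + card (Irr - {m})"
    using finite_Ap finite_Irr by (metis Diff_disjoint Int_Diff Int_commute card_Un_disjoint finite_Diff inf.right_idem inf_commute)
  moreover have "card (Ap - {0}) = m - 1" using card_Ap zero_Ap finite_Ap by simp
  moreover have "card (Irr - {m}) = card Irr - 1" "card Irr > 0"
    using m_in_Irr finite_Irr by (auto simp: card_gt_0_iff)
  ultimately show ?thesis using m_pos by simp
qed

text \<open>\<open>Ap\<close> is closed under taking summands in \<open>S\<close>, and each of two
  nonzero summands witnesses that the other is not maximal.\<close>

lemma decomposableE:
  assumes "w \<in> Ap - {0} - Irr"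
  obtains u v where "u \<in> NonMax" "v \<in> NonMax" "w = u + v"
proof -
  obtain u v where uv: "u \<in> S" "v \<in> S" "w = u + v" "u \<noteq> 0" "v \<noteq> 0"
    using assms Ap_in unfolding Irr_def by blast
  then have "u \<in> Ap - {0}" "v \<in> Ap - {0}" "u + v \<in> Ap"
    using Ap_left Ap_right assms by auto
  then have "u \<in> NonMax" "v \<in> NonMax" unfolding NonMax_def by (auto simp: add.commute)
  then show thesis using that uv by blast
qed

section \<open>Maximal Apery elements and the type bound\<close>

lemma below_maximal:
  assumes "w \<in> Ap" "w \<noteq> 0"
  shows "\<exists>v\<in>Maxl. \<exists>s\<in>S. v = w + s"
  using assms
proof (induction "F + m - w" arbitrary: w rule: less_induct)
  case less
  show ?case
  proof (cases "w \<in> Maxl")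
    case True then show ?thesis using zero by force
  next
    case False
    then obtain v where v: "v \<in> Ap" "v \<noteq> 0" "w + v \<in> Ap"
      using less.prems unfolding Maxl_def NonMax_def by blast
    have "F + m - (w + v) < F + m - w" using Ap_le[OF v(3)] v(2) by simp
    then obtain x s where "x \<in> Maxl" "s \<in> S" "x = w + v + s"
      using less.hyps[of "w + v"] v by auto
    then show ?thesis using add[OF Ap_in[OF v(1)]] by (metis add.assoc)
  qed
qed

lemma maximal_eq:
  assumes "w \<in> Maxl" "s \<in> S" "w + s \<in> Ap"
  shows "s = 0"
proof -
  have "w \<in> Ap" "w \<noteq> 0" "w \<notin> NonMax" using assms(1) by (auto simp: Maxl_def)
  moreover have "s \<in> Ap" using Ap_right assms \<open>w \<in> Ap\<close> Ap_in by blast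
  ultimately show ?thesis using assms(3) unfolding NonMax_def by blast
qed

lemma finite_below: "finite {s \<in> S. s < F}"
  by simp

lemma card_gaps: "card ({..F} - S) + card {s \<in> S. s < F} = F + 1"
proof -
  have "{..F} = ({..F} - S) \<union> {s \<in> S. s < F}" using F_notin by (auto simp: order_le_less)
  then have "card {..F} = card ({..F} - S) + card {s \<in> S. s < F}"
    by (metis (no_types, lifting) Diff_disjoint card_Un_disjoint disjoint_iff
        finite_Diff finite_atMost finite_below DiffD2 mem_Collect_eq)
  then show ?thesis by simp
qed

lemma type_bound: "F + 1 \<le> (card Maxl + 1) * card {s \<in> S. s < F}"
proof -
  let ?N = "{s \<in> S. s < F}"
  have ex: "\<exists>p. p \<in> Maxl \<times> ?N \<and> g = fst p - m - snd p" if g: "g \<in> {..F} - S" for g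
  proof -
    have "Suc F \<le> Suc F * m" using m_pos by (metis Suc_leI One_nat_def mult_le_mono2 nat_mult_1_right)
    then have "g + Suc F * m \<in> S" using F_less by auto
    then obtain w l where w: "w \<in> Ap" "g + Suc F * m = w + l * m" using in_S_decompose by blast
    have "l < Suc F"
    proof (rule ccontr)
      assume "\<not> l < Suc F"
      then have "l * m = (l - Suc F) * m + Suc F * m"
        by (metis add_mult_distrib le_add_diff_inverse2 not_less)
      then have "g = w + (l - Suc F) * m" using w(2) by linarith
      then show False using g add[OF Ap_in[OF w(1)] mult_m_in] by simp
    qed
    then obtain k where "Suc F = l + Suc k" by (metis less_iff_Suc_add add_Suc_right)
    then have gw: "w = g + m + k * m" using w(2) by (simp add: add_mult_distrib)
    then have "w \<noteq> 0" using m_pos by simp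
    then obtain x s where x: "x \<in> Maxl" "s \<in> S" "x = w + s" using below_maximal w(1) by blast
    \<comment> \<open>As \<open>x = g + m + (s + k * m)\<close>, this bounds
      \<open>s + k * m\<close> by \<open>F\<close>; being in \<open>S\<close>, it differs from
      \<open>F\<close>.\<close>
    have "x \<le> F + m" using x(1) Ap_le by (auto simp: Maxl_def)
    moreover have sk: "s + k * m \<in> S" using x(2) add mult_m_in by blast
    moreover from sk have "s + k * m \<noteq> F" using F_notin by metis
    ultimately have "s + k * m < F" using gw x(3) by linarith
    then show ?thesis using x sk gw by (intro exI[of _ "(x, s + k * m)"]) auto
  qed
  have "{..F} - S \<subseteq> (\<lambda>p. fst p - m - snd p) ` (Maxl \<times> ?N)" using ex by blast
  moreover have "finite (Maxl \<times> ?N)" using finite_Ap by (auto simp: Maxl_def)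
  ultimately have "card ({..F} - S) \<le> card (Maxl \<times> ?N)" by (meson surj_card_le)
  then show ?thesis using card_gaps by (simp add: card_cartesian_product)
qed

section \<open>Depths of Apery elements\<close>

lemma sum_depth_le: "(\<Sum>w\<in>Ap. depth w) \<le> card {s \<in> S. s < F}"
proof -
  let ?A = "Sigma Ap (\<lambda>w. {..<depth w})"
  have "inj_on (\<lambda>(w, k). w + k * m) ?A"
    by (rule inj_onI) (use Ap_mult_unique in auto)
  moreover have "(\<lambda>(w, k). w + k * m) ` ?A \<subseteq> {s \<in> S. s < F}"
  proof clarify
    fix w k assume w: "w \<in> Ap" and k: "k < depth w"
    have "Suc k * m \<le> depth w * m" using k by (metis Suc_leI mult_le_mono1)
    also have "\<dots> \<le> F + m - w" by (simp add: depth_def)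
    finally have le: "w + k * m \<le> F" using Ap_le[OF w] by simp
    have "w + k * m \<in> S" using add[OF Ap_in[OF w] mult_m_in] .
    moreover from this have "w + k * m \<noteq> F" using F_notin by auto
    ultimately show "w + k * m \<in> S \<and> w + k * m < F" using le by simp
  qed
  ultimately have "card ?A \<le> card {s \<in> S. s < F}"
    by (rule card_inj_on_le[OF _ _ finite_below])
  then show ?thesis using finite_Ap by (simp add: card_SigmaI)
qed

abbreviation q :: nat where "q \<equiv> (F + m) div m"

lemma depth_pos: assumes "w \<in> NonMax" shows "1 \<le> depth w"
proof -
  obtain v where "v \<in> Ap" "v \<noteq> 0" "w + v \<in> Ap" using assms unfolding NonMax_def by blast
  then have "m < v" "w + v \<le> F + m" using Ap_gt_m Ap_le by auto
  then have "m \<le> F + m - w" by simp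
  then show ?thesis unfolding depth_def using m_pos
    by (metis div_greater_zero_iff less_eq_Suc_le One_nat_def)
qed

text \<open>\<open>F + m - u\<close> and \<open>F + m - v\<close> add up to at least
  \<open>F + m\<close>, and rounding down both quotients by \<open>m\<close> costs at most one. If
  \<open>F + m\<close> has remainder \<open>m - 1\<close>, the two remainders together exceed it by
  less than \<open>m\<close>, so nothing is lost.\<close>

lemma depth_add:
  assumes "u + v \<in> Ap"
  shows "q \<le> depth u + depth v + 1"
    and "(F + m) mod m = m - 1 \<Longrightarrow> q \<le> depth u + depth v"
proof -
  let ?a = "F + m - u" and ?b = "F + m - v"
  have le: "u + v \<le> F + m" using assms Ap_le by blast
  have ab: "F + m \<le> ?a + ?b" using le by simp
  have a: "?a = depth u * m + ?a mod m" and b: "?b = depth v * m + ?b mod m"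
    unfolding depth_def by simp_all
  have r: "?a mod m < m" "?b mod m < m" using m_pos by auto
  have W: "F + m = q * m + (F + m) mod m" by (rule div_mult_mod_eq[symmetric])
  have 1: "q * m + (F + m) mod m \<le> (depth u + depth v) * m + (?a mod m + ?b mod m)"
    using ab a b W by (metis (no_types, lifting) add.assoc add.left_commute add_mult_distrib)
  have "q * m < (depth u + depth v + 2) * m"
    using 1 r unfolding add_mult_distrib mult_2 by linarith
  then show "q \<le> depth u + depth v + 1" using m_pos by (simp only: mult_less_cancel2) simp
  assume "(F + m) mod m = m - 1"
  then have "q * m < (depth u + depth v + 1) * m"
    using 1 r unfolding add_mult_distrib mult_1 by linarith
  then show "q \<le> depth u + depth v" using m_pos by (simp only: mult_less_cancel2) simp
qed

text \<open>Writing \<open>F + 1 = q m - \<rho>\<close> with \<open>0 \<le> \<rho> < m\<close>, the element \<open>0\<close> accounts for \<open>q\<close> of the \<open>n\<close>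
  elements below \<open>F\<close>, so for \<open>m = \<nu> + 5\<close> the inequality \<open>F + 1 \<le> \<nu> n\<close> follows from
  \<open>5 q \<le> \<nu> D + \<rho>\<close>, where \<open>D\<close> is the total depth of the nonzero Apery elements.\<close>

lemma wilf_of_depth:
  assumes "m = \<nu> + 5"
    and "5 * q + (F + m) mod m + 1 \<le> \<nu> * (\<Sum>w\<in>NonMax. depth w) + m"
  shows "F + 1 \<le> \<nu> * card {s \<in> S. s < F}"
proof -
  have "(\<Sum>w\<in>insert 0 NonMax. depth w) \<le> (\<Sum>w\<in>Ap. depth w)"
    by (rule sum_mono2) (use finite_Ap zero_Ap in \<open>auto simp: NonMax_def\<close>)
  moreover have "(\<Sum>w\<in>insert 0 NonMax. depth w) = q + (\<Sum>w\<in>NonMax. depth w)"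
    using finite_Ap by (subst sum.insert) (auto simp: NonMax_def depth_def)
  ultimately have "q + (\<Sum>w\<in>NonMax. depth w) \<le> card {s \<in> S. s < F}"
    using sum_depth_le by simp
  then have "\<nu> * q + \<nu> * (\<Sum>w\<in>NonMax. depth w) \<le> \<nu> * card {s \<in> S. s < F}"
    by (metis add_mult_distrib2 mult_le_mono2)
  moreover have "F + m = q * m + (F + m) mod m" by (rule div_mult_mod_eq[symmetric])
  then have "F + m = \<nu> * q + 5 * q + (F + m) mod m"
    using assms(1) by (metis add_mult_distrib mult.commute)
  ultimately show ?thesis using assms(2) by linarith
qed

lemma card_NonMax_Maxl: "card NonMax + card Maxl + 1 = m"
proof -
  have "Ap = insert 0 (NonMax \<union> Maxl)" "0 \<notin> NonMax \<union> Maxl" "NonMax \<inter> Maxl = {}"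
    using zero_Ap by (auto simp: NonMax_def Maxl_def)
  then show ?thesis
    using card_Ap finite_NonMax finite_Maxl
    by (metis Suc_eq_plus1 card_Un_disjoint card_insert_disjoint finite_UnI)
qed

section \<open>Number of maximal elements for at most three generators\<close>

lemma combination_in:
  assumes "a \<in> S" "b \<in> S" shows "i * a + j * b \<in> S"
proof -
  have "k * x \<in> S" if "x \<in> S" for k x
    by (induction k) (auto intro: zero add that)
  then show ?thesis using assms add by blast
qed

text \<open>\<open>a\<close> and \<open>b\<close> may coincide or vanish, so that semigroups with
  fewer atoms are covered too.\<close>

lemma Ap_representation:
  assumes "Irr - {m} \<subseteq> {a, b}"
  shows "w \<in> Ap \<Longrightarrow> \<exists>i j. w = i * a + j * b"
proof (induction w rule: less_induct)
  case (less w)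
  consider "w = 0" | "w \<in> Irr" | "w \<in> Ap - {0} - Irr" using less.prems by blast
  then show ?case
  proof cases
    case 1 then show ?thesis by simp
  next
    case 2
    then have "w = a \<or> w = b" using assms less.prems m_notin_Ap by blast
    then show ?thesis by (metis add.right_neutral add_0 mult_0 nat_mult_1)
  next
    case 3
    then obtain u v where uv: "u \<in> NonMax" "v \<in> NonMax" "w = u + v"
      using decomposableE by blast
    then have "u \<in> Ap" "v \<in> Ap" "u < w" "v < w" by (auto simp: NonMax_def)
    then obtain i j k l where "u = i * a + j * b" "v = k * a + l * b" using less.IH by meson
    then have "w = (i + k) * a + (j + l) * b" using uv(3) by (simp add: add_mult_distrib)
    then show ?thesis by blast
  qed
qed

lemma Maxl_Ap: "w \<in> Maxl \<Longrightarrow> w \<in> Ap"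
  by (simp add: Maxl_def)

lemma type_one:
  assumes "Irr - {m} \<subseteq> {a}" "a \<in> S"
  shows "card Maxl \<le> 1"
proof -
  have le: "x = y" if xy: "x \<in> Maxl" "y \<in> Maxl" "x \<le> y" for x y
  proof -
    have gen: "Irr - {m} \<subseteq> {a, a}" using assms(1) by simp
    obtain i j where "x = i * a + j * a" using Ap_representation[OF gen Maxl_Ap[OF xy(1)]] by blast
    moreover obtain k l where "y = k * a + l * a"
      using Ap_representation[OF gen Maxl_Ap[OF xy(2)]] by blast
    ultimately have x: "x = (i + j) * a" and y: "y = (k + l) * a" by (simp_all add: add_mult_distrib)
    then have "y = x + ((k + l) - (i + j)) * a" using that(3)
      by (metis diff_mult_distrib le_add_diff_inverse)
    moreover have "((k + l) - (i + j)) * a \<in> S"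
      using combination_in[OF assms(2) zero, of _ 0] by simp
    ultimately show ?thesis using maximal_eq that Maxl_Ap by (metis add.right_neutral)
  qed
  then have "x = y" if "x \<in> Maxl" "y \<in> Maxl" for x y using that by (metis nle_le)
  then show ?thesis using finite_Maxl by (metis One_nat_def card_le_Suc0_iff_eq)
qed

text \<open>A minimal pair \<open>(i, j)\<close> with \<open>i a + j b \<notin> Ap\<close> and \<open>i, j > 0\<close> must represent a multiple of \<open>m\<close>:
  otherwise a generator could be cancelled from \<open>i a + j b - m\<close>.\<close>

lemma inner_corner:
  assumes gen: "Irr - {m} \<subseteq> {a, b}" "a \<in> S" "b \<in> S"
    and p: "i1 * a + j1 * b \<in> Ap" "i2 * a + j2 * b \<in> Ap" "i2 * a + j1 * b \<notin> Ap"
    and less: "i1 < i2" "j2 < j1"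
  obtains i j where "i1 < i" "i \<le> i2" "j2 < j" "j \<le> j1" "m dvd i * a + j * b"
    "(i - 1) * a + j * b \<in> Ap" "i * a + (j - 1) * b \<in> Ap"
proof -
  have down: "k * a + l * b \<in> Ap" if "k' * a + l' * b \<in> Ap" "k \<le> k'" "l \<le> l'" for k l k' l'
  proof -
    have "k' * a + l' * b = (k * a + l * b) + ((k' - k) * a + (l' - l) * b)"
      by (rule combination_split[OF that(2,3)])
    then show ?thesis using Ap_left combination_in[OF gen(2,3)] that(1) by metis
  qed
  \<comment> \<open>Move along row \<open>j1\<close> to the first point outside \<open>Ap\<close>,
    then down that column to the lowest such point: both \<open>(i - 1, j)\<close> and
    \<open>(i, j - 1)\<close> then represent Apery elements.\<close>
  define i where "i = (LEAST i. i * a + j1 * b \<notin> Ap)"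
  have i: "i * a + j1 * b \<notin> Ap" unfolding i_def by (rule LeastI) (rule p(3))
  have i_le: "i \<le> i2" unfolding i_def by (rule Least_le) (rule p(3))
  have i_gt: "i1 < i" using i down[OF p(1), of i j1] by (metis le_refl not_less)
  have i_pred: "(i - 1) * a + j1 * b \<in> Ap"
    using not_less_Least[of "i - 1" "\<lambda>i. i * a + j1 * b \<notin> Ap"] i_gt unfolding i_def[symmetric] by simp
  define j where "j = (LEAST j. i * a + j * b \<notin> Ap)"
  have j: "i * a + j * b \<notin> Ap" unfolding j_def by (rule LeastI) (rule i)
  have j_le: "j \<le> j1" unfolding j_def by (rule Least_le) (rule i)
  have j_gt: "j2 < j" using j down[OF p(2), of i j] i_le by (meson not_less)
  have j_pred: "i * a + (j - 1) * b \<in> Ap"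
    using not_less_Least[of "j - 1" "\<lambda>j. i * a + j * b \<notin> Ap"] j_gt unfolding j_def[symmetric] by simp
  have i_pred': "(i - 1) * a + j * b \<in> Ap" using down[OF i_pred] j_le by simp
  have "i * a + j * b \<in> S" using combination_in gen by blast
  then obtain w k where w: "w \<in> Ap" "i * a + j * b = w + k * m" using in_S_decompose by blast
  have "0 < k" using w j by (cases k) auto
  obtain x y where xy: "w = x * a + y * b" using Ap_representation[OF gen(1) w(1)] by blast
  have "x = 0"
  proof (rule ccontr)
    assume "x \<noteq> 0"
    then obtain x' where "x = Suc x'" using not0_implies_Suc by blast
    then have "a + ((i - 1) * a + j * b) = a + ((x' * a + y * b) + k * m)"
      using w(2) xy combination_split[of "i - 1" i j j a b] i_gt by simp
    then have "(i - 1) * a + j * b = (x' * a + y * b) + k * m" by (rule add_left_imp_eq)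
    then show False using i_pred' Ap_add_mult_notin[OF combination_in[OF gen(2,3)] \<open>0 < k\<close>] by metis
  qed
  moreover have "y = 0"
  proof (rule ccontr)
    assume "y \<noteq> 0"
    then obtain y' where "y = Suc y'" using not0_implies_Suc by blast
    then have "b + (i * a + (j - 1) * b) = b + ((x * a + y' * b) + k * m)"
      using w(2) xy combination_split[of i i "j - 1" j a b] j_gt by simp
    then have "i * a + (j - 1) * b = (x * a + y' * b) + k * m" by (rule add_left_imp_eq)
    then show False using j_pred Ap_add_mult_notin[OF combination_in[OF gen(2,3)] \<open>0 < k\<close>] by metis
  qed
  ultimately have "m dvd i * a + j * b" using w(2) xy by simp
  then show thesis using that i_gt i_le j_gt j_le i_pred' j_pred by blast
qed

text \<open>Three maximal elements, seen as lattice points \<open>(I w, J w)\<close>, form a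
  descending staircase with two inner corners, both multiples of \<open>m\<close>. Comparing the
  corners gives an equality between a multiple of \<open>a\<close> and a positive multiple of
  \<open>b\<close>, against the choice of \<open>J\<close>.\<close>

lemma type_two:
  assumes gen: "Irr - {m} \<subseteq> {a, b}" "a \<in> S" "b \<in> S"
  shows "card Maxl \<le> 2"
proof (rule ccontr)
  assume "\<not> card Maxl \<le> 2"
  then have "3 \<le> card Maxl" by simp
  then obtain X where X: "X \<subseteq> Maxl" "card X = 3" using obtain_subset_with_card_n by metis
  \<comment> \<open>Representations need not be unique; fixing the least coefficient of
    \<open>b\<close> serves the final contradiction.\<close>
  define J where "J w = (LEAST j. \<exists>i. w = i * a + j * b)" for w
  define I where "I w = (SOME i. w = i * a + J w * b)" for w
  have rep: "w = I w * a + J w * b" if "w \<in> Ap" for w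
  proof -
    have "\<exists>j i. w = i * a + j * b" using Ap_representation[OF gen(1) that] by blast
    then have "\<exists>i. w = i * a + J w * b" unfolding J_def by (rule LeastI_ex)
    then show ?thesis unfolding I_def by (rule someI_ex)
  qed
  have J_le: "J w \<le> j" if "w = i * a + j * b" for w i j
    unfolding J_def by (rule Least_le) (use that in blast)
  have incomp: "J y < J x" if "x \<in> Maxl" "y \<in> Maxl" "x \<noteq> y" "I x \<le> I y" for x y
  proof (rule ccontr)
    assume "\<not> J y < J x"
    then have "y = x + ((I y - I x) * a + (J y - J x) * b)"
      using rep[OF Maxl_Ap[OF that(1)]] rep[OF Maxl_Ap[OF that(2)]] that(4)
        combination_split[of "I x" "I y" "J x" "J y" a b] by simp
    then show False using maximal_eq[OF that(1) combination_in[OF gen(2,3)]] Maxl_Ap[OF that(2)] that(3)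
      by (metis add.right_neutral)
  qed
  have False if M: "x \<in> Maxl" "y \<in> Maxl" "z \<in> Maxl" and ne: "x \<noteq> y" "y \<noteq> z"
    and le: "I x \<le> I y" "I y \<le> I z" for x y z
  proof -
    note Ap = M[THEN Maxl_Ap]
    have corner: thesis
      if xy: "x \<in> Maxl" "y \<in> Maxl" "x \<noteq> y" "I x \<le> I y" and
        *: "\<And>i j. I x < i \<Longrightarrow> i \<le> I y \<Longrightarrow> J y < j \<Longrightarrow> j \<le> J x \<Longrightarrow> m dvd i * a + j * b \<Longrightarrow>
          (i - 1) * a + j * b \<in> Ap \<Longrightarrow> i * a + (j - 1) * b \<in> Ap \<Longrightarrow> thesis" for x y thesis
    proof -
      have J: "J y < J x" using incomp xy by blast
      have I: "I x < I y"
        using incomp[of y x] xy J by (metis order_less_asym order_le_less)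
      \<comment> \<open>The outer corner \<open>(I y, J x)\<close> lies outside \<open>Ap\<close>:
        it exceeds the maximal element \<open>x\<close> by a nonzero multiple of
        \<open>a\<close>.\<close>
      have "I y * a + J x * b = x + (I y - I x) * a"
        using rep[OF Maxl_Ap[OF xy(1)]] I combination_split[of "I x" "I y" "J x" "J x" a b] by simp
      moreover have "(I y - I x) * a \<in> S" using combination_in[OF gen(2) zero, of _ 0] by simp
      moreover have "(I y - I x) * a \<noteq> 0"
      proof
        assume "(I y - I x) * a = 0"
        \<comment> \<open>The hypotheses allow \<open>a = 0\<close>; then \<open>x\<close> and
          \<open>y\<close> are multiples of \<open>b\<close>, hence comparable.\<close>
        then have "a = 0" using I by simp
        then have "y = 0 * a + J y * b" "x = 0 * a + J x * b"
          using rep[OF Maxl_Ap[OF xy(1)]] rep[OF Maxl_Ap[OF xy(2)]] by simp_all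
        then have "x = y + (0 * a + (J x - J y) * b)"
          using J combination_split[of 0 0 "J y" "J x" a b] by simp
        then show False
          using maximal_eq[OF xy(2) combination_in[OF gen(2,3)]] Maxl_Ap[OF xy(1)] xy(3)
          by (metis add.right_neutral)
      qed
      ultimately have "I y * a + J x * b \<notin> Ap" using maximal_eq[OF xy(1)] by metis
      then show thesis
        using inner_corner[OF gen _ _ _ I J] * rep[OF Maxl_Ap[OF xy(1)]] rep[OF Maxl_Ap[OF xy(2)]]
          Maxl_Ap[OF xy(1)] Maxl_Ap[OF xy(2)] by metis
    qed
    obtain i j where ij: "I x < i" "i \<le> I y" "J y < j" "j \<le> J x" "m dvd i * a + j * b"
      "i * a + (j - 1) * b \<in> Ap"
      using corner[OF M(1,2) ne(1) le(1)] by metis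
    obtain k l where kl: "I y < k" "k \<le> I z" "J z < l" "l \<le> J y" "m dvd k * a + l * b"
      "(k - 1) * a + l * b \<in> Ap"
      using corner[OF M(2,3) ne(2) le(2)] by metis
    let ?d = "k - i" and ?e = "j - l"
    \<comment> \<open>Since \<open>l \<ge> 1\<close>, at least \<open>?e\<close> copies of
      \<open>b\<close> remain in this Apery element, so \<open>?e * b\<close> is a summand of
      it.\<close>
    have "i * a + (j - 1) * b = ?e * b + (i * a + (l - 1) * b)"
      using kl ij combination_split[of i i "l - 1" "j - 1" a b] by simp
    then have eAp: "?e * b \<in> Ap"
      using Ap_left[OF _ combination_in[OF gen(2,3)]] combination_in[OF zero gen(3), of 0 ?e] ij(6)
      by (metis add_0 mult_0)
    have "(k - 1) * a + l * b = ?d * a + ((i - 1) * a + l * b)"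
      using kl ij combination_split[of "i - 1" "k - 1" l l a b] by simp
    then have dAp: "?d * a \<in> Ap"
      using Ap_left[OF _ combination_in[OF gen(2,3)]] combination_in[OF gen(2) zero, of ?d 0] kl(6)
      by (metis add.right_neutral mult_0_right)
    have k: "k = i + ?d" and j: "j = l + ?e" using kl ij by auto
    have "k * a + l * b = ?d * a + (i * a + l * b)" by (subst k) (simp add: add_mult_distrib)
    moreover have "i * a + j * b = ?e * b + (i * a + l * b)" by (subst j) (simp add: add_mult_distrib)
    \<comment> \<open>Both corners vanish modulo \<open>m\<close>; cancelling their common part
      leaves two congruent Apery elements, which must be equal.\<close>
    ultimately have "(?d * a + (i * a + l * b)) mod m = (?e * b + (i * a + l * b)) mod m"
      using ij(5) kl(5) by (metis dvd_imp_mod_0)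
    then obtain r s where "?d * a + (i * a + l * b) + m * r = ?e * b + (i * a + l * b) + m * s"
      unfolding nat_mod_eq_iff by blast
    then have "?d * a + m * r = ?e * b + m * s" by linarith
    then have "(?d * a) mod m = (?e * b) mod m" unfolding nat_mod_eq_iff by blast
    then have eq: "?d * a = ?e * b" using Ap_mod_inj dAp eAp by blast
    \<comment> \<open>Trading \<open>?e * b\<close> for \<open>?d * a\<close> in \<open>x\<close>
      lowers the coefficient of \<open>b\<close> below its minimum \<open>J x\<close>.\<close>
    have "x = I x * a + (J x - ?e) * b + ?e * b"
      using rep[OF Ap(1)] ij(3,4) combination_split[of "I x" "I x" "J x - ?e" "J x" a b] by simp
    then have "x = (I x + ?d) * a + (J x - ?e) * b" using eq by (simp add: add_mult_distrib)
    then have "J x \<le> J x - ?e" by (rule J_le)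
    then show False using kl ij by simp
  qed
  note no = this
  obtain x y z where "X = {x, y, z}" "x \<noteq> y" "y \<noteq> z" "x \<noteq> z" using X(2) by (metis card_3_iff)
  then show False using X(1) no[of x y z] no[of x z y] no[of y x z] no[of y z x] no[of z x y] no[of z y x]
    by (metis insert_subset nle_le)
qed

section \<open>Wilf's inequality by embedding dimension\<close>

abbreviation Dec :: "nat set" where "Dec \<equiv> Ap - {0} - Irr"

lemma Dec_subset: "Dec \<subseteq> {u + v | u v. u \<in> NonMax \<and> v \<in> NonMax \<and> u + v \<in> Ap}"
  using decomposableE by blast

lemma wilf_of_type:
  assumes "card Maxl + 1 \<le> \<nu>"
  shows "F + 1 \<le> \<nu> * card {s \<in> S. s < F}"
  using type_bound mult_le_mono1[OF assms] by (meson le_trans)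

lemma wilf_large_embdim:
  assumes m: "m = \<nu> + 5" and \<nu>: "5 \<le> \<nu>" and Dec: "card Dec = 5"
  shows "F + 1 \<le> \<nu> * card {s \<in> S. s < F}"
proof (rule wilf_of_depth[OF m])
  \<comment> \<open>This suffices because \<open>\<nu> \<ge> 5\<close> and the remainder of
    \<open>F + m\<close> is below \<open>m\<close>.\<close>
  have "q \<le> (\<Sum>w\<in>NonMax. depth w)"
  proof (cases "\<exists>u\<in>NonMax. \<exists>v\<in>NonMax. u \<noteq> v \<and> u + v \<in> Ap")
    case True
    then obtain u v where uv: "u \<in> NonMax" "v \<in> NonMax" "u \<noteq> v" "u + v \<in> Ap" by blast
    \<comment> \<open>Two vertices carry at most three edges, so there is a third; its positive
      depth makes up for the 1 lost in \<open>depth_add\<close>.\<close>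
    have "\<exists>x. x \<in> NonMax - {u, v}"
    proof (rule ccontr)
      assume "\<not> ?thesis"
      then have "NonMax \<subseteq> {u, v}" by blast
      then have "Dec \<subseteq> {u + u, u + v, v + v}"
        using Dec_subset add.commute[of v u] by blast
      then have "card Dec \<le> card {u + u, u + v, v + v}" by (rule card_mono[rotated]) simp
      also have "\<dots> \<le> 3" by (simp add: card_insert_if)
      finally show False using Dec by simp
    qed
    then obtain x where x: "x \<in> NonMax" "x \<noteq> u" "x \<noteq> v" by blast
    have "(\<Sum>w\<in>{u, v, x}. depth w) \<le> (\<Sum>w\<in>NonMax. depth w)"
      by (rule sum_mono2) (use finite_NonMax uv x in auto)
    then show ?thesis using depth_add(1)[OF uv(4)] depth_pos[OF x(1)] uv x by simp
  next
    case False
    \<comment> \<open>All five edges are loops, so at least five elements have twice their depth at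
      least \<open>max 2 (q - 1)\<close>, and \<open>5 * max 2 (q - 1) \<ge> 2 * q\<close>.\<close>
    let ?U = "{u \<in> NonMax. q \<le> 2 * depth u + 1}"
    have "Dec \<subseteq> (\<lambda>u. u + u) ` ?U"
    proof
      fix w assume "w \<in> Dec"
      then obtain u v where "u \<in> NonMax" "v \<in> NonMax" "u + v \<in> Ap" "w = u + v"
        using Dec_subset by blast
      moreover from this have "u = v" using False by blast
      ultimately show "w \<in> (\<lambda>u. u + u) ` ?U" using depth_add(1)[of u u] by auto
    qed
    then have "card Dec \<le> card ?U" using finite_NonMax by (simp add: surj_card_le)
    moreover have "card ?U * max 2 (q - 1) \<le> (\<Sum>u\<in>?U. 2 * depth u)"
      using sum_bounded_below[of ?U "max 2 (q - 1)" "\<lambda>u. 2 * depth u"] depth_pos by fastforce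
    moreover have "(\<Sum>u\<in>?U. 2 * depth u) \<le> (\<Sum>u\<in>NonMax. 2 * depth u)"
      by (rule sum_mono2) (use finite_NonMax in auto)
    moreover have "(\<Sum>u\<in>NonMax. 2 * depth u) = 2 * (\<Sum>u\<in>NonMax. depth u)"
      by (rule sum_distrib_left[symmetric])
    moreover have "5 * max 2 (q - 1) \<le> card ?U * max 2 (q - 1)"
      using \<open>card Dec \<le> card ?U\<close> Dec by (intro mult_le_mono1) simp
    ultimately have "5 * max 2 (q - 1) \<le> 2 * (\<Sum>w\<in>NonMax. depth w)" by linarith
    then show ?thesis by linarith
  qed
  then have "5 * q \<le> \<nu> * (\<Sum>w\<in>NonMax. depth w)" using \<nu> by (meson mult_le_mono)
  moreover have "(F + m) mod m < m" using m_pos by simp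
  ultimately show "5 * q + (F + m) mod m + 1 \<le> \<nu> * (\<Sum>w\<in>NonMax. depth w) + m" by linarith
qed

text \<open>Passes from edges to numerical weights: \<open>ps\<close> lists every unordered pair,
  loops included, and a pair determines its sum, so distinct decomposable elements use distinct
  pairs.\<close>

lemma card_Dec_le_filter:
  assumes "\<And>u v. u \<in> NonMax \<Longrightarrow> v \<in> NonMax \<Longrightarrow> (u, v) \<in> set ps \<or> (v, u) \<in> set ps"
    and "\<And>u v. u + v \<in> Ap \<Longrightarrow> P (depth u) (depth v)"
  shows "card Dec \<le> length (filter (\<lambda>(x, y). P x y) (map (\<lambda>(u, v). (depth u, depth v)) ps))"
proof -
  let ?qs = "filter (\<lambda>(u, v). P (depth u) (depth v)) ps"
  have "Dec \<subseteq> (\<lambda>(u, v). u + v) ` set ?qs"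
  proof
    fix w assume "w \<in> Dec"
    then obtain u v where uv: "u \<in> NonMax" "v \<in> NonMax" "u + v \<in> Ap" "w = u + v"
      using Dec_subset by blast
    have "P (depth u) (depth v)" "P (depth v) (depth u)"
      using assms(2) uv(3) by (auto simp: add.commute)
    then have "(u, v) \<in> set ?qs \<or> (v, u) \<in> set ?qs" using assms(1)[OF uv(1,2)] by auto
    then show "w \<in> (\<lambda>(u, v). u + v) ` set ?qs" using uv(4) by (force simp: add.commute)
  qed
  then have "card Dec \<le> card (set ?qs)" by (simp add: surj_card_le)
  also have "\<dots> \<le> length ?qs" by (rule card_length)
  also have "\<dots> = length (filter (\<lambda>(x, y). P x y) (map (\<lambda>(u, v). (depth u, depth v)) ps))"
    by (simp add: filter_map o_def case_prod_unfold)
  finally show ?thesis .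
qed

lemma wilf_embdim_four:
  assumes m: "m = 9" and Dec: "card Dec = 5"
  shows "F + 1 \<le> 4 * card {s \<in> S. s < F}"
proof (cases "card Maxl \<le> 3")
  case True
  then show ?thesis using wilf_of_type by simp
next
  case False
  have mod: "(F + m) mod m < m" using m_pos by simp
  have "card NonMax \<le> 4" using False card_NonMax_Maxl m by simp
  moreover have "\<not> card NonMax \<le> 2"
  proof
    assume c: "card NonMax \<le> 2"
    have "Dec \<subseteq> (\<lambda>(u, v). u + v) ` (NonMax \<times> NonMax)" using Dec_subset by auto
    then have "card Dec \<le> card (NonMax \<times> NonMax)"
      using finite_NonMax by (intro surj_card_le) auto
    also have "\<dots> \<le> 2 * 2" unfolding card_cartesian_product by (intro mult_le_mono c)
    finally show False using Dec by simp
  qed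
  ultimately consider "card NonMax = 3" | "card NonMax = 4" by linarith
  then have "5 * q + (F + m) mod m + 1 \<le> 4 * (\<Sum>w\<in>NonMax. depth w) + m"
  proof cases
    case 1
    then obtain x y z where N: "NonMax = {x, y, z}" "x \<noteq> y" "x \<noteq> z" "y \<noteq> z"
      by (metis card_3_iff)
    let ?ps = "[(x, x), (x, y), (x, z), (y, y), (y, z), (z, z)]"
    have sum: "(\<Sum>w\<in>NonMax. depth w) = depth x + depth y + depth z" using N by simp
    have pos: "1 \<le> depth x" "1 \<le> depth y" "1 \<le> depth z" using depth_pos N by auto
    have "card Dec \<le> length (filter (\<lambda>(a, b). q \<le> a + b + 1) (map (\<lambda>(u, v). (depth u, depth v)) ?ps))"
      by (rule card_Dec_le_filter) (use N depth_add(1) in auto)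
    then have b1: "3 * q \<le> 2 * (depth x + depth y + depth z) + 3 * 1"
      using Dec by (intro three_weights) simp
    have b0: "3 * q \<le> 2 * (depth x + depth y + depth z) + 3 * 0" if "(F + m) mod m = m - 1"
    proof -
      have "card Dec \<le> length (filter (\<lambda>(a, b). q \<le> a + b + 0) (map (\<lambda>(u, v). (depth u, depth v)) ?ps))"
        by (rule card_Dec_le_filter) (use N depth_add(2) that in auto)
      then show ?thesis using Dec by (intro three_weights) simp
    qed
    show ?thesis
    proof (rule ccontr)
      assume neg: "\<not> ?thesis"
      \<comment> \<open>The weight bounds leave only this exceptional case, which is excluded by the
        actual sizes of the elements.\<close>
      have "q = 3 \<and> depth x + depth y + depth z = 3 \<and> 6 \<le> (F + m) mod m"
      proof -
        have arith: "k = 3 \<and> D = 3 \<and> 6 \<le> r"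
          if "\<not> 5 * k + r + 1 \<le> 4 * D + 9" "3 * k \<le> 2 * D + 3" "r = 8 \<longrightarrow> 3 * k \<le> 2 * D"
            "3 \<le> D" "r < 9" for k D r :: nat
        proof -
          have r: "r \<le> 7" using that by linarith
          then have "k \<le> 4" using that(1,2) by linarith
          then consider "k \<le> 2" | "k = 3" | "k = 4" by linarith
          then show ?thesis
          proof cases
            case 1
            then show ?thesis using that(1,4) r by linarith
          next
            case 2
            then have "D \<le> 3" using that(1) r by linarith
            then show ?thesis using that(1,4) 2 by linarith
          next
            case 3
            then have "5 \<le> D" using that(2) by linarith
            then show ?thesis using that(1) r 3 by linarith
          qed
        qed
        show ?thesis by (rule arith) (use neg b1 b0 pos mod sum m in auto)
      qed
      then have q3: "q = 3" and d1: "depth x = 1" "depth y = 1" "depth z = 1"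
        and r: "6 \<le> (F + m) mod m" using pos by auto
      have "F + m = q * m + (F + m) mod m" by (rule div_mult_mod_eq[symmetric])
      moreover have "q * m = 3 * m" by (simp only: q3)
      \<comment> \<open>Here \<open>33 = 3 * 9 + 6\<close>. Depth 1 puts each \<open>u\<close>
        within \<open>17 = 2 * 9 - 1\<close> of \<open>F + m\<close>, and a partner \<open>v\<close>
        with \<open>u + v \<le> F + m\<close> puts it at distance at least
        \<open>v \<ge> 33 - 17 = 16\<close>. Three distinct elements cannot share two
        distances.\<close>
      ultimately have W: "33 \<le> F + m" using r m by linarith
      have d1: "depth u = 1" if "u \<in> NonMax" for u using d1 N that by auto
      have upper: "F + m - u \<le> 17" if "u \<in> NonMax" for u
        using d1[OF that] m unfolding depth_def by simp
      have "16 \<le> F + m - u" if u: "u \<in> NonMax" for u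
      proof -
        obtain v where v: "v \<in> Ap - {0}" "u + v \<in> Ap" using u unfolding NonMax_def by blast
        then have "v \<in> NonMax" using u unfolding NonMax_def by (auto simp: add.commute)
        then show ?thesis using upper[of v] W Ap_le[OF v(2)] by linarith
      qed
      then have "16 \<le> F + m - x" "16 \<le> F + m - y" "16 \<le> F + m - z" using N by auto
      moreover have "F + m - x \<le> 17" "F + m - y \<le> 17" "F + m - z \<le> 17" using upper N by auto
      ultimately show False using N(2-4) by linarith
    qed
  next
    case 2
    then obtain x y z t where N: "NonMax = {x, y, z, t}" "distinct [x, y, z, t]"
      by (auto simp: numeral_eq_Suc card_Suc_eq)
    let ?ps = "[(x, x), (x, y), (x, z), (x, t), (y, y), (y, z), (y, t), (z, z), (z, t), (t, t)]"
    have sum: "(\<Sum>w\<in>NonMax. depth w) = depth x + depth y + depth z + depth t" using N by simp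
    have "card Dec \<le> length (filter (\<lambda>(a, b). q \<le> a + b + 1) (map (\<lambda>(u, v). (depth u, depth v)) ?ps))"
      by (rule card_Dec_le_filter) (use N depth_add(1) in auto)
    then have "5 * q \<le> 4 * (depth x + depth y + depth z + depth t)"
      using Dec depth_pos N by (intro four_weights) simp_all
    then have "5 * q + ((F + m) mod m + 1) \<le> 4 * (depth x + depth y + depth z + depth t) + m"
      using mod by (intro add_mono) simp_all
    then show ?thesis by (simp only: sum add.assoc)
  qed
  then show ?thesis by (rule wilf_of_depth[rotated]) (simp add: m)
qed

lemma wilf_codim_five:
  assumes m: "m = card Irr + 5"
  shows "F + 1 \<le> card Irr * card {s \<in> S. s < F}"
proof -
  have Dec: "card Dec = 5" using card_decomposable m by simp
  have card: "card (Irr - {m}) = card Irr - 1" and pos: "0 < card Irr"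
    using m_in_Irr finite_Irr by (auto simp: card_gt_0_iff)
  have Irr_S: "Irr \<subseteq> S" by (auto simp: Irr_def)
  consider "card Irr = 1" | "card Irr = 2" | "card Irr = 3" | "card Irr = 4" | "5 \<le> card Irr"
    using pos by linarith
  then show ?thesis
  proof cases
    case 1
    \<comment> \<open>With \<open>m\<close> as the only atom, \<open>Ap\<close> is
      \<open>{0}\<close> and \<open>m\<close> is 1, whereas here \<open>m = 6\<close>.\<close>
    then have "Irr - {m} \<subseteq> {0, 0}" using card finite_Irr by auto
    then have "Ap \<subseteq> {0}" using Ap_representation[of 0 0] by auto
    then have "card Ap \<le> 1" using card_mono[of "{0}" Ap] by simp
    then show ?thesis using card_Ap m by simp
  next
    case 2
    then obtain a where a: "Irr - {m} = {a}" using card by (auto simp: card_1_singleton_iff)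
    then have "card Maxl \<le> 1" using type_one[of a] Irr_S by blast
    then show ?thesis using wilf_of_type 2 by simp
  next
    case 3
    then obtain a b where "Irr - {m} = {a, b}" using card by (auto simp: card_2_iff)
    then have "card Maxl \<le> 2" using type_two[of a b] Irr_S by blast
    then show ?thesis using wilf_of_type 3 by simp
  next
    case 4
    then show ?thesis using wilf_embdim_four m Dec by simp
  next
    case 5
    then show ?thesis using wilf_large_embdim m Dec by blast
  qed
qed

section \<open>Identification of the defined invariants\<close>

lemma subset_submonoid_of_Irr:
  assumes "add_submonoid T" "Irr \<subseteq> T"
  shows "S \<subseteq> T"
proof
  fix s show "s \<in> S \<Longrightarrow> s \<in> T"
  proof (induction s rule: less_induct)
    case (less s)
    consider "s = 0" | "s \<in> Irr" | u v where "u \<in> S" "v \<in> S" "s = u + v" "u \<noteq> 0" "v \<noteq> 0"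
      using less.prems unfolding Irr_def by blast
    then show ?case
    proof cases
      case 3
      then have "u \<in> T" "v \<in> T" using less.IH by auto
      then show ?thesis using assms(1) 3 by (auto simp: add_submonoid_def)
    qed (use assms in \<open>auto simp: add_submonoid_def\<close>)
  qed
qed

text \<open>Removing an atom from \<open>S\<close> leaves a submonoid, so a generating set must
  contain every atom; conversely the atoms generate \<open>S\<close>.\<close>

lemma embedding_dimension_eq: "embedding_dimension S = card Irr"
  unfolding embedding_dimension_def
proof (rule Least_equality)
  have S: "add_submonoid S" using zero add by (auto simp: add_submonoid_def)
  have "add_submonoid hull Irr = S"
  proof
    show "add_submonoid hull Irr \<subseteq> S" by (rule hull_minimal) (use S in \<open>auto simp: Irr_def\<close>)
    show "S \<subseteq> add_submonoid hull Irr" unfolding hull_def using subset_submonoid_of_Irr by blast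
  qed
  then show "\<exists>A. finite A \<and> card A = card Irr \<and> add_submonoid hull A = S" using finite_Irr by blast
  fix k assume "\<exists>A. finite A \<and> card A = k \<and> add_submonoid hull A = S"
  then obtain A where A: "finite A" "card A = k" "add_submonoid hull A = S" by blast
  have "Irr \<subseteq> A"
  proof
    fix x assume x: "x \<in> Irr"
    show "x \<in> A"
    proof (rule ccontr)
      assume "x \<notin> A"
      then have "A \<subseteq> S - {x}" using A(3) hull_subset[of A add_submonoid] by blast
      moreover have "add_submonoid (S - {x})"
        unfolding add_submonoid_def
      proof (intro conjI ballI)
        show "0 \<in> S - {x}" using x zero by (auto simp: Irr_def)
        fix u v assume "u \<in> S - {x}" "v \<in> S - {x}"
        then show "u + v \<in> S - {x}" using x add unfolding Irr_def
          by (metis (mono_tags, lifting) Diff_iff add.right_neutral add_0 insertE insertI1 emptyE mem_Collect_eq)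
      qed
      ultimately have "S \<subseteq> S - {x}" using hull_minimal A(3) by metis
      then show False using x by (auto simp: Irr_def)
    qed
  qed
  then show "card Irr \<le> k" using A card_mono by blast
qed

lemma frobenius_number_eq: "frobenius_number S = int F"
  unfolding frobenius_number_def
proof (rule Greatest_equality)
  show "int F \<notin> int ` S" using F_notin by auto
  fix z assume z: "z \<notin> int ` S"
  show "z \<le> int F"
  proof (rule ccontr)
    assume "\<not> z \<le> int F"
    then have "nat z \<in> S" "z = int (nat z)" using F_less[of "nat z"] by auto
    then show False using z by blast
  qed
qed

end

theorem theorem2:
  fixes S :: "nat set"
  assumes "numerical_semigroup S"
    and "int (semigroup_multiplicity S) - int (embedding_dimension S) = 5"
  shows "frobenius_number S + 1 \<le> int (embedding_dimension S * num_below_frobenius S)"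
proof -
  define m where "m = semigroup_multiplicity S"
  define F where "F = Max (- S)"
  have S: "add_submonoid S" and fin: "finite (- S)"
    using assms(1) by (auto simp: numerical_semigroup_def)
  have "\<exists>s. s \<in> S \<and> s \<noteq> 0"
  proof (rule ccontr)
    assume "\<not> ?thesis"
    then have "- {0} \<subseteq> - S" by auto
    then have "finite (- {0::nat})" using fin finite_subset by blast
    then show False by simp
  qed
  then have m: "m \<in> S \<and> m \<noteq> 0"
    unfolding m_def semigroup_multiplicity_def by (rule LeastI_ex)
  have m_le: "m \<le> s" if "s \<in> S" "s \<noteq> 0" for s
    unfolding m_def semigroup_multiplicity_def by (rule Least_le) (use that in blast)
  have "m \<ge> 5" using assms(2) by (simp add: m_def)
  \<comment> \<open>A gap exists, so the maximum defining \<open>F\<close> is taken over a nonempty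
    set.\<close>
  then have "1 \<in> - S" using m_le[of 1] by auto
  then have F: "F \<in> - S" unfolding F_def using Max_in[OF fin] by blast
  interpret numsgp S m F
  proof
    show "s \<in> S" if "F < s" for s
      using that Max_ge[OF fin, of s] unfolding F_def by fastforce
  qed (use S m m_le F in \<open>auto simp: add_submonoid_def\<close>)
  have "m = card Irr + 5" using assms(2) embedding_dimension_eq by (simp add: m_def)
  then have "F + 1 \<le> card Irr * card {s \<in> S. s < F}" by (rule wilf_codim_five)
  then have "int (F + 1) \<le> int (card Irr * card {s \<in> S. s < F})" by (simp only: of_nat_le_iff)
  then show ?thesis
    by (simp add: embedding_dimension_eq frobenius_number_eq num_below_frobenius_def)
qed

end
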